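(* For each $k$ let $\lambda(x)=\frac{1+|x|^2}{2}$ for $x\in\mathbb{R}^k$. Let $A$ be a real $n\times m$ matrix with rows $A^1,\ldots,A^n$. (1) The linear map $\varphi:\mathbb{R}^{m}\to(\mathbb{R}^{n},\lambda^{-2}\delta_{ij})\equiv(S^{n}\setminus\{N\},g_{can})$, $\varphi(X)=(A^{1}X,\cdots,A^{n}X)$, from a Euclidean space (with its standard metric) into a sphere is $\infty$-harmonic if and only if $A=0$, i.e., $\varphi$ is a constant map. (2) The linear map $\varphi:(\mathbb{R}^{m},\lambda^{-2}\delta_{ij})\equiv(S^{m}\setminus\{N\},g_{can})\to\mathbb{R}^{n}$, $\varphi(X)=(A^{1}X,\cdots,A^{n}X)$, from a sphere into a Euclidean space (with its standard metric) is $\infty$-harmonic if and only if $A=0$, i.e., $\varphi$ is a constant map.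
   Context: A smooth map $\varphi:(M,g)\to(N,h)$ between Riemannian manifolds is called $\infty$-harmonic if $\tfrac12\,{\rm d}\varphi({\rm grad}\,|{\rm d}\varphi|^2)=0$ on $M$, where $|{\rm d}\varphi|^2={\rm Trace}_g\,\varphi^*h$ is the energy density of $\varphi$ and the gradient is taken with respect to $g$. The $k$-sphere with its standard metric minus a point, $(S^{k}\setminus\{N\},g_{can})$, is identified (via stereographic projection) with $\mathbb{R}^k$ endowed with the metric $\left(\frac{1+|x|^2}{2}\right)^{-2}\delta_{ij}$. *)

theory Defs
  imports "HOL-Analysis.Analysis"
begin

section \<open>Smooth maps\<close>

text \<open>The recursion asks for the directional derivatives only; in finite dimension, continuity of all
  directional derivatives of a differentiable map is continuity of its derivative.\<close>

fun C_k :: "nat \<Rightarrow> ('a::euclidean_space \<Rightarrow> 'b::euclidean_space) \<Rightarrow> bool" where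
  "C_k 0 f \<longleftrightarrow> continuous_on UNIV f"
| "C_k (Suc k) f \<longleftrightarrow>
     f differentiable_on UNIV \<and> (\<forall>v. C_k k (\<lambda>x. frechet_derivative f (at x) v))"

definition smooth :: "('a::euclidean_space \<Rightarrow> 'b::euclidean_space) \<Rightarrow> bool" where
  "smooth f \<longleftrightarrow> (\<forall>k. C_k k f)"

section \<open>Riemannian metrics on coordinate space\<close>

text \<open>A Riemannian metric on \<open>\<real>\<^sup>k\<close> is given by its Gram matrix in the standard coordinates:
  \<open>g x $ i $ j = g\<^sub>x(\<partial>\<^sub>i, \<partial>\<^sub>j)\<close>. All formulas below are with respect to
  these global coordinates, so \<open>matrix_inv (g x)\<close> has the entries \<open>g\<^sup>i\<^sup>j\<close>.\<close>

definition riemannian_metric :: "(real^'k \<Rightarrow> real^'k^'k) \<Rightarrow> bool" where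
  "riemannian_metric g \<longleftrightarrow> smooth g \<and>
     (\<forall>x. transpose (g x) = g x \<and> (\<forall>v. v \<noteq> 0 \<longrightarrow> v \<bullet> (g x *v v) > 0))"

definition pullback_metric ::
  "(real^'m \<Rightarrow> real^'n) \<Rightarrow> (real^'n \<Rightarrow> real^'n^'n) \<Rightarrow> real^'m \<Rightarrow> real^'m^'m" where
  "pullback_metric \<phi> h x =
     transpose (jacobian \<phi> (at x)) ** h (\<phi> x) ** jacobian \<phi> (at x)"

text \<open>\<open>|d\<phi>|\<^sup>2 = Trace\<^sub>g \<phi>\<^sup>*h = g\<^sup>i\<^sup>j (\<phi>\<^sup>*h)\<^sub>j\<^sub>i\<close>\<close>

definition energy_density ::
  "(real^'m \<Rightarrow> real^'m^'m) \<Rightarrow> (real^'n \<Rightarrow> real^'n^'n) \<Rightarrow> (real^'m \<Rightarrow> real^'n) \<Rightarrow> real^'m \<Rightarrow> real" where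
  "energy_density g h \<phi> x = trace (matrix_inv (g x) ** pullback_metric \<phi> h x)"

text \<open>\<open>(grad\<^sub>g f)\<^sup>i = g\<^sup>i\<^sup>j \<partial>\<^sub>j f\<close>\<close>

definition riemannian_grad ::
  "(real^'m \<Rightarrow> real^'m^'m) \<Rightarrow> (real^'m \<Rightarrow> real) \<Rightarrow> real^'m \<Rightarrow> real^'m" where
  "riemannian_grad g f x = matrix_inv (g x) *v (\<chi> j. frechet_derivative f (at x) (axis j 1))"

definition infinity_harmonic ::
  "(real^'m \<Rightarrow> real^'m^'m) \<Rightarrow> (real^'n \<Rightarrow> real^'n^'n) \<Rightarrow> (real^'m \<Rightarrow> real^'n) \<Rightarrow> bool" where
  "infinity_harmonic g h \<phi> \<longleftrightarrow>
     riemannian_metric g \<and> riemannian_metric h \<and> smooth \<phi> \<and>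
     (\<forall>x. (1/2) *\<^sub>R
        frechet_derivative \<phi> (at x) (riemannian_grad g (energy_density g h \<phi>) x) = 0)"

section \<open>The Euclidean metric and the metric of the punctured sphere\<close>

definition flat_metric :: "real^'k \<Rightarrow> real^'k^'k" where
  "flat_metric x = mat 1"

definition conformal_factor :: "real^'k \<Rightarrow> real" where
  "conformal_factor x = (1 + (norm x)\<^sup>2) / 2"

definition sphere_metric :: "real^'k \<Rightarrow> real^'k^'k" where
  "sphere_metric x = mat (1 / (conformal_factor x)\<^sup>2)"

subsection \<open>Both are Riemannian metrics\<close>

lemma C_k_const: "C_k k (\<lambda>x. c)"
  by (induction k arbitrary: c) (auto simp: frechet_derivative_const)

lemma C_k_SucI:
  assumes "\<And>x. (f has_derivative f' x) (at x)" and "\<And>v. C_k k (\<lambda>x. f' x v)"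
  shows "C_k (Suc k) f"
proof -
  have "(\<lambda>x. frechet_derivative f (at x) v) = (\<lambda>x. f' x v)" for v
    using frechet_derivative_at[OF assms(1)] by auto
  moreover have "f differentiable_on UNIV"
    using assms(1) by (auto simp: differentiable_on_def differentiable_def)
  ultimately show ?thesis using assms(2) by simp
qed

lemma C_k_SucD:
  assumes "C_k (Suc k) f"
  shows "(f has_derivative frechet_derivative f (at x)) (at x)"
    and "C_k k (\<lambda>x. frechet_derivative f (at x) v)"
  using assms by (auto simp: differentiable_on_def frechet_derivative_works)

lemma C_k_Suc_imp: "C_k (Suc k) f \<Longrightarrow> C_k k f"
proof (induction k arbitrary: f)
  case 0
  then show ?case by (simp add: differentiable_imp_continuous_on)
next
  case (Suc k)
  then show ?case
    by (metis C_k.simps(2))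
qed

lemma C_k_bounded_linear:
  assumes "bounded_linear f" shows "C_k k f"
proof (cases k)
  case 0
  then show ?thesis using assms by (simp add: linear_continuous_on)
next
  case (Suc n)
  show ?thesis unfolding Suc
    by (rule C_k_SucI[where f' = "\<lambda>x. f"])
      (auto intro: bounded_linear_imp_has_derivative assms C_k_const)
qed

lemma C_k_add: "C_k k f \<Longrightarrow> C_k k g \<Longrightarrow> C_k k (\<lambda>x. f x + g x)"
proof (induction k arbitrary: f g)
  case 0
  then show ?case by (simp add: continuous_on_add)
next
  case (Suc k)
  show ?case
    by (rule C_k_SucI[OF has_derivative_add[OF C_k_SucD(1)[OF Suc.prems(1)]
          C_k_SucD(1)[OF Suc.prems(2)]]])
      (intro Suc.IH C_k_SucD(2)[OF Suc.prems(1)] C_k_SucD(2)[OF Suc.prems(2)])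
qed

lemma C_k_scaleR: "C_k k f \<Longrightarrow> C_k k g \<Longrightarrow> C_k k (\<lambda>x. f x *\<^sub>R g x)"
proof (induction k arbitrary: f g)
  case 0
  then show ?case by (simp add: continuous_on_scaleR)
next
  case (Suc k)
  show ?case
    by (rule C_k_SucI[OF has_derivative_scaleR[OF C_k_SucD(1)[OF Suc.prems(1)]
          C_k_SucD(1)[OF Suc.prems(2)]]])
      (intro Suc.IH C_k_add C_k_SucD(2)[OF Suc.prems(1)] C_k_SucD(2)[OF Suc.prems(2)]
        C_k_Suc_imp[OF Suc.prems(1)] C_k_Suc_imp[OF Suc.prems(2)])
qed

lemma has_derivative_inverse_one_plus_norm_sq:
  fixes x :: "'a::euclidean_space"
  shows "((\<lambda>x. inverse (1 + x \<bullet> x)) has_derivative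
    (\<lambda>v. - 2 * (x \<bullet> v) * (inverse (1 + x \<bullet> x))\<^sup>2)) (at x)"
proof -
  have "1 + x \<bullet> x \<noteq> 0"
    using inner_ge_zero[of x] by linarith
  then show ?thesis
    by (auto intro!: derivative_eq_intros simp: inner_commute power2_eq_square)
qed

lemma C_k_inverse_one_plus_norm_sq:
  "C_k k (\<lambda>x::'a::euclidean_space. inverse (1 + x \<bullet> x))"
proof (induction k)
  case 0
  have "1 + x \<bullet> x \<noteq> 0" for x :: 'a
    using inner_ge_zero[of x] by linarith
  then show ?case by (auto intro!: continuous_intros)
next
  case (Suc k)
  let ?r = "\<lambda>x::'a. inverse (1 + x \<bullet> x)"
  have "C_k k (\<lambda>x. (- 2 * (x \<bullet> v)) *\<^sub>R (?r x *\<^sub>R ?r x))" for v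
    by (intro C_k_scaleR Suc C_k_bounded_linear bounded_linear_const_mult bounded_linear_inner_left)
  then show ?case
    by (intro C_k_SucI[OF has_derivative_inverse_one_plus_norm_sq])
      (simp add: power2_eq_square mult.assoc)
qed

lemma mat_eq_scaleR: "mat c = c *\<^sub>R (mat 1 :: real^'k^'k)"
  by (simp add: vec_eq_iff mat_def)

lemma riemannian_metric_conformal:
  fixes f :: "real^'k \<Rightarrow> real"
  assumes "smooth f" and "\<And>x. f x > 0"
  shows "riemannian_metric (\<lambda>x. mat (f x) :: real^'k^'k)"
proof -
  have "smooth (\<lambda>x. mat (f x) :: real^'k^'k)"
    using assms(1) unfolding smooth_def mat_eq_scaleR[of "f _"] by (auto intro: C_k_scaleR C_k_const)
  moreover have "v \<bullet> ((mat (f x) :: real^'k^'k) *v v) > 0" if "v \<noteq> 0" for v x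
    using that assms(2)[of x]
    by (simp add: mat_eq_scaleR[of "f x"] scaleR_matrix_vector_assoc[symmetric])
  ultimately show ?thesis
    by (simp add: riemannian_metric_def)
qed

lemma riemannian_flat_metric:
  "riemannian_metric (flat_metric :: real^'k \<Rightarrow> real^'k^'k)"
  using riemannian_metric_conformal[of "\<lambda>_::real^'k. 1"]
  by (simp add: flat_metric_def[abs_def] smooth_def C_k_const)

lemma conformal_factor_pos: "conformal_factor x > 0"
  unfolding conformal_factor_def by (simp add: add_pos_nonneg)

lemma riemannian_sphere_metric:
  "riemannian_metric (sphere_metric :: real^'k \<Rightarrow> real^'k^'k)"
proof -
  let ?r = "\<lambda>x::real^'k. inverse (1 + x \<bullet> x)"
  have "(\<lambda>x::real^'k. 1 / (conformal_factor x)\<^sup>2) = (\<lambda>x. 4 *\<^sub>R (?r x *\<^sub>R ?r x))"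
    unfolding conformal_factor_def power2_norm_eq_inner
    by (simp add: power2_eq_square inverse_eq_divide)
  then have "smooth (\<lambda>x::real^'k. 1 / (conformal_factor x)\<^sup>2)"
    unfolding smooth_def
    by (simp only:) (intro allI C_k_scaleR C_k_const C_k_inverse_one_plus_norm_sq)
  then show ?thesis
    unfolding sphere_metric_def[abs_def]
    by (rule riemannian_metric_conformal) (simp add: conformal_factor_pos less_imp_neq[THEN not_sym])
qed

subsection \<open>The sphere metric comes from stereographic projection\<close>

text \<open>The unit sphere sits in \<open>\<real>\<^sup>k \<times> \<real>\<close>, with \<open>N = (0, 1)\<close>.\<close>

definition inv_stereographic :: "real^'k \<Rightarrow> (real^'k) \<times> real" where
  "inv_stereographic x =
     ((2 / (1 + (norm x)\<^sup>2)) *\<^sub>R x, ((norm x)\<^sup>2 - 1) / (1 + (norm x)\<^sup>2))"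

lemma inv_stereographic_alt:
  "inv_stereographic x = ((2 * inverse (1 + x \<bullet> x)) *\<^sub>R x, 1 - 2 * inverse (1 + x \<bullet> x))"
proof -
  have "1 + x \<bullet> x \<noteq> 0"
    using inner_ge_zero[of x] by linarith
  then show ?thesis
    by (simp add: inv_stereographic_def power2_norm_eq_inner field_simps)
qed

lemma bij_betw_inv_stereographic:
  "bij_betw (inv_stereographic :: real^'k \<Rightarrow> _) UNIV (sphere 0 1 - {(0, 1)})"
proof (rule bij_betwI[where g = "\<lambda>p. (1 / (1 - snd p)) *\<^sub>R fst p"])
  have pos: "1 + x \<bullet> x > 0" for x :: "real^'k"
    using inner_ge_zero[of x] by linarith
  show "(inv_stereographic :: real^'k \<Rightarrow> _) \<in> UNIV \<rightarrow> sphere 0 1 - {(0, 1)}"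
  proof (intro funcsetI)
    fix x :: "real^'k"
    let ?r = "inverse (1 + x \<bullet> x)"
    have r: "?r * (1 + x \<bullet> x) = 1" using pos[of x] by simp
    have "inv_stereographic x \<bullet> inv_stereographic x
      = 4 * ?r * (?r * (1 + x \<bullet> x)) + 1 - 4 * ?r"
      by (simp add: inv_stereographic_alt algebra_simps power2_eq_square)
    then have "inv_stereographic x \<bullet> inv_stereographic x = 1"
      unfolding r by simp
    then have "norm (inv_stereographic x) = 1"
      by (simp add: norm_eq_sqrt_inner)
    moreover have "snd (inv_stereographic x) \<noteq> 1"
      using pos[of x] by (simp add: inv_stereographic_alt)
    ultimately show "inv_stereographic x \<in> sphere 0 1 - {(0, 1)}"
      by auto
  qed
  show "(1 / (1 - snd (inv_stereographic x))) *\<^sub>R fst (inv_stereographic x) = x"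
    for x :: "real^'k"
    using pos[of x] by (simp add: inv_stereographic_alt)
  show "inv_stereographic ((1 / (1 - snd p)) *\<^sub>R fst p) = p"
    if "p \<in> sphere 0 1 - {(0, 1)}" for p :: "(real^'k) \<times> real"
  proof -
    obtain y t where p: "p = (y, t)" by (cases p)
    have "p \<bullet> p = 1" using that by (simp add: norm_eq_sqrt_inner)
    then have yt: "y \<bullet> y = 1 - t * t" by (simp add: p)
    have "t \<noteq> 1"
    proof
      assume "t = 1"
      with yt have "y = 0" by simp
      with \<open>t = 1\<close> that p show False by simp
    qed
    then have t: "1 - t \<noteq> 0" by simp
    have "1 + (y \<bullet> y) / ((1 - t) * (1 - t)) = 2 / (1 - t)"
      unfolding yt using t by (simp add: divide_simps) (simp add: algebra_simps)
    then have inv: "inverse (1 + ((1 / (1 - t)) *\<^sub>R y) \<bullet> ((1 / (1 - t)) *\<^sub>R y)) = (1 - t) / 2"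
      by (simp add: inverse_eq_divide)
    then show ?thesis
      unfolding inv_stereographic_alt p fst_conv snd_conv inv using t by (simp add: field_simps)
  qed
qed simp

lemma sphere_metric_eq_pullback:
  fixes x u v :: "real^'k"
  shows "frechet_derivative inv_stereographic (at x) u \<bullet>
      frechet_derivative inv_stereographic (at x) v = u \<bullet> (sphere_metric x *v v)"
proof -
  define r where "r = inverse (1 + x \<bullet> x)"
  have "1 + x \<bullet> x \<noteq> 0"
    using inner_ge_zero[of x] by linarith
  then have "(1 + x \<bullet> x) * r = 1"
    by (simp add: r_def)
  then have r: "x \<bullet> x * r = 1 - r"
    by (simp add: algebra_simps)
  let ?D = "\<lambda>u. ((2 * r) *\<^sub>R u + (2 * (- 2 * (x \<bullet> u) * r\<^sup>2)) *\<^sub>R x,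
    - (2 * (- 2 * (x \<bullet> u) * r\<^sup>2)))"
  have "(inv_stereographic has_derivative ?D) (at x)"
    unfolding inv_stereographic_alt[abs_def] r_def
    by (rule derivative_eq_intros refl has_derivative_inverse_one_plus_norm_sq | simp)+
  then have D: "frechet_derivative inv_stereographic (at x) = ?D"
    by (rule frechet_derivative_at[symmetric])
  have "?D u \<bullet> ?D v = 4 * r\<^sup>2 * (u \<bullet> v) - 16 * r^3 * (x \<bullet> u) * (x \<bullet> v)
      + 16 * r^3 * (x \<bullet> u) * (x \<bullet> v) * (x \<bullet> x * r + r)"
    by (simp add: inner_add_left inner_add_right inner_commute power2_eq_square power3_eq_cube
        algebra_simps)
  also have "\<dots> = 4 * r\<^sup>2 * (u \<bullet> v)"
    unfolding r by simp
  also have "4 * r\<^sup>2 = 1 / (conformal_factor x)\<^sup>2"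
    by (simp add: r_def conformal_factor_def power2_norm_eq_inner power_divide power_inverse
        inverse_eq_divide)
  finally show ?thesis
    unfolding D
    by (simp add: sphere_metric_def mat_eq_scaleR[of "1 / _"] scaleR_matrix_vector_assoc[symmetric])
qed

end

theory Submission
  imports Defs
begin

text \<open>Write \<open>s = tr (A\<^sup>T A)\<close>, which vanishes only for \<open>A = 0\<close>. Into the sphere the energy density is
  \<open>s / \<lambda>(A x)\<^sup>2\<close>, whose gradient is a nonzero multiple of \<open>s A\<^sup>T A x\<close>; so \<open>s A A\<^sup>T A = 0\<close>, and
  \<open>A A\<^sup>T A = 0\<close> forces \<open>A = 0\<close>. From the sphere it is \<open>s \<lambda>(x)\<^sup>2\<close>, whose gradient is a nonzero
  multiple of \<open>s x\<close>; so \<open>s A = 0\<close>.\<close>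

lemma matrix_inv_mat:
  fixes c :: real
  assumes "c \<noteq> 0"
  shows "matrix_inv (mat c :: real^'k^'k) = mat (inverse c)"
proof -
  let ?M = "mat c :: real^'k^'k" and ?N = "mat (inverse c) :: real^'k^'k"
  have inv: "?M ** ?N = mat 1" "?N ** ?M = mat 1"
    using assms by (simp_all add: mat_eq_scaleR[of c] mat_eq_scaleR[of "inverse c"]
        scalar_matrix_assoc[symmetric] matrix_scalar_ac)
  \<comment> \<open>\<open>matrix_inv\<close> is a Hilbert choice, so the explicit inverse
    \<open>?N\<close> serves as witness that the chosen matrix inverts \<open>?M\<close>;
    multiplying by \<open>?N\<close> on the left then identifies the two.\<close>
  then have "?M ** matrix_inv ?M = mat 1"
    unfolding matrix_inv_def by (rule someI2[where a = ?N, OF conjI]) blast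
  then show ?thesis
    by (metis inv(2) matrix_mul_assoc matrix_mul_lid matrix_mul_rid)
qed

lemma trace_scaleR: "trace (c *\<^sub>R M) = c * trace (M :: real^'k^'k)"
  by (simp add: trace_def sum_distrib_left)

text \<open>The trace is the sum of the squares of all entries of \<open>A\<close>.\<close>

lemma trace_transpose_mult_eq_0_iff:
  fixes A :: "real^'m^'n"
  shows "trace (transpose A ** A) = 0 \<longleftrightarrow> A = 0"
  by (simp add: trace_def matrix_matrix_mult_def transpose_def sum_nonneg_eq_0_iff sum_nonneg
      vec_eq_iff) blast

text \<open>Adjointness is used twice: |A^T A x|^2 = <A x, A A^T A x> = 0, and then |A x|^2 = <A^T A
  x, x> = 0.\<close>

lemma matrix_transpose_matrix_eq_0:
  fixes A :: "real^'m^'n"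
  assumes "\<And>x. A *v (transpose A *v (A *v x)) = 0"
  shows "A = 0"
proof -
  have adj: "(transpose A *v y) \<bullet> z = y \<bullet> (A *v z)" for y z
    by (simp add: dot_lmul_matrix)
  have "A *v x = 0" for x
  proof -
    let ?y = "transpose A *v (A *v x)"
    have "?y \<bullet> ?y = (A *v x) \<bullet> (A *v ?y)"
      by (rule adj)
    then have "?y = 0"
      unfolding assms by simp
    then have "(A *v x) \<bullet> (A *v x) = 0"
      using adj[of "A *v x" x] by simp
    then show ?thesis by simp
  qed
  then show ?thesis
    by (simp add: matrix_eq)
qed

lemma frechet_derivative_matrix_vector_mult:
  "frechet_derivative ((*v) (A :: real^'m^'n)) (at x) = (*v) A"
  by (metis bounded_linear_imp_has_derivative frechet_derivative_at matrix_vector_mul_bounded_linear)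

text \<open>The Jacobian is \<open>A\<close> at every point, so the pullback metric is
  \<open>b (A *v x)\<close> times A^T A.\<close>

lemma energy_density_conformal_linear:
  fixes A :: "real^'m^'n"
  assumes "a x \<noteq> 0"
  shows "energy_density (\<lambda>x. mat (a x)) (\<lambda>y. mat (b y)) ((*v) A) x
    = inverse (a x) * b (A *v x) * trace (transpose A ** A)"
  unfolding energy_density_def pullback_metric_def jacobian_def
    frechet_derivative_matrix_vector_mult matrix_of_matrix_vector_mul matrix_inv_mat[of "a x", OF assms]
    mat_eq_scaleR[of "b _"] mat_eq_scaleR[of "inverse _"]
  by (simp add: scalar_matrix_assoc[symmetric] matrix_scalar_ac trace_scaleR)

lemma riemannian_grad_conformal:
  assumes "a x \<noteq> 0" and "(f has_derivative (\<lambda>v. w \<bullet> v)) (at x)"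
  shows "riemannian_grad (\<lambda>x. mat (a x)) f x = inverse (a x) *\<^sub>R w"
proof -
  have "(\<chi> j. frechet_derivative f (at x) (axis j 1)) = w"
    by (simp add: frechet_derivative_at[OF assms(2), symmetric] vec_eq_iff inner_axis)
  then show ?thesis
    by (simp add: riemannian_grad_def matrix_inv_mat assms(1) mat_eq_scaleR[of "inverse _"]
        scaleR_matrix_vector_assoc[symmetric])
qed

text \<open>Treats both directions, into and from the sphere, at once. By \<open>D\<close>, the
  Euclidean gradient of the energy density is \<open>w\<close> times the constant \<open>?s\<close>,
  and the metric of the domain only contributes the nonzero factor \<open>inverse (a x)\<close>. The
  alternative \<open>A = 0\<close> is the case \<open>?s = 0\<close>.\<close>

lemma infinity_harmonic_conformal_linear:
  fixes A :: "real^'m^'n"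
  assumes g: "riemannian_metric (\<lambda>x::real^'m. mat (a x) :: real^'m^'m)"
    and h: "riemannian_metric (\<lambda>y::real^'n. mat (b y) :: real^'n^'n)"
    and a: "\<And>x. a x \<noteq> 0"
    and D: "\<And>x. ((\<lambda>x. inverse (a x) * b (A *v x)) has_derivative (\<lambda>v. w x \<bullet> v)) (at x)"
  shows "infinity_harmonic (\<lambda>x. mat (a x)) (\<lambda>y. mat (b y)) ((*v) A)
    \<longleftrightarrow> A = 0 \<or> (\<forall>x. A *v w x = 0)"
proof -
  let ?s = "trace (transpose A ** A)"
  let ?e = "energy_density (\<lambda>x. mat (a x)) (\<lambda>y. mat (b y)) ((*v) A)"
  have "(?e has_derivative (\<lambda>v. (?s *\<^sub>R w x) \<bullet> v)) (at x)" for x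
    unfolding energy_density_conformal_linear[of a, OF a]
    using has_derivative_mult_left[OF D[of x], of ?s] by (simp add: mult.commute)
  then have "riemannian_grad (\<lambda>x. mat (a x)) ?e x = inverse (a x) *\<^sub>R ?s *\<^sub>R w x" for x
    by (intro riemannian_grad_conformal a)
  moreover have "smooth ((*v) A)"
    by (simp add: smooth_def C_k_bounded_linear)
  ultimately show ?thesis
    by (auto simp: infinity_harmonic_def g h a frechet_derivative_matrix_vector_mult
        matrix_vector_mult_scaleR trace_transpose_mult_eq_0_iff)
qed

lemma has_derivative_conformal_factor:
  "(conformal_factor has_derivative (\<lambda>v. x \<bullet> v)) (at x)"
  unfolding conformal_factor_def[abs_def] power2_norm_eq_inner
  by (auto intro!: derivative_eq_intros simp: inner_commute)

lemma infinity_harmonic_linear_into_sphere: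
  fixes A :: "real^'m^'n"
  shows "infinity_harmonic flat_metric sphere_metric ((*v) A) \<longleftrightarrow> A = 0"
proof -
  let ?l = "\<lambda>x. conformal_factor (A *v x)"
  \<comment> \<open>Chain rule: \<open>conformal_factor\<close> has Euclidean gradient y at y, so
    \<open>?l\<close> has gradient A^T A x, and its power -2 contributes the scalar.\<close>
  let ?w = "\<lambda>x. (- 2 / ?l x ^ 3) *\<^sub>R (transpose A *v (A *v x))"
  have l: "?l x \<noteq> 0" for x
    using conformal_factor_pos[of "A *v x"] by simp
  \<comment> \<open>The factor \<open>inverse 1\<close> keeps the shape of the premise
    \<open>D\<close> for a flat domain.\<close>
  have "((\<lambda>x. inverse 1 * (1 / (?l x)\<^sup>2)) has_derivative (\<lambda>v. ?w x \<bullet> v)) (at x)" for x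
  proof -
    have "(?l has_derivative (\<lambda>v. (A *v x) \<bullet> (A *v v))) (at x)"
      by (rule has_derivative_compose[OF _ has_derivative_conformal_factor])
        (simp add: bounded_linear_imp_has_derivative)
    note [derivative_intros] = this
    show ?thesis
      by (rule derivative_eq_intros refl | simp add: l)+
        (auto simp: fun_eq_iff dot_lmul_matrix field_simps l eval_nat_numeral)
  qed
  from infinity_harmonic_conformal_linear[of "\<lambda>_. 1", OF _ _ _ this]
  have "infinity_harmonic flat_metric sphere_metric ((*v) A) \<longleftrightarrow> A = 0 \<or> (\<forall>x. A *v ?w x = 0)"
    using riemannian_flat_metric riemannian_sphere_metric
    by (simp add: flat_metric_def[abs_def] sphere_metric_def[abs_def])
  also have "\<dots> \<longleftrightarrow> A = 0"
    \<comment> \<open>The nonzero scalar in \<open>?w\<close> cancels. The rule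
      \<open>transpose_matrix_vector\<close> is switched off because it would rewrite
      \<open>transpose A *v y\<close> to \<open>y v* A\<close>.\<close>
    using matrix_transpose_matrix_eq_0[of A] l
    by (auto simp: matrix_vector_mult_scaleR simp del: transpose_matrix_vector scaleR_minus_left)
  finally show ?thesis .
qed

lemma infinity_harmonic_linear_from_sphere:
  fixes A :: "real^'m^'n"
  shows "infinity_harmonic sphere_metric flat_metric ((*v) A) \<longleftrightarrow> A = 0"
proof -
  let ?l = "conformal_factor :: real^'m \<Rightarrow> real"
  have l: "?l x \<noteq> 0" for x
    using conformal_factor_pos[of x] by simp
  \<comment> \<open>Inverting the metric of the domain gives the square of \<open>?l\<close>, whose
    Euclidean gradient is radial, so \<open>A\<close> is tested on multiples of every
    vector.\<close>
  have "((\<lambda>x. inverse (1 / (?l x)\<^sup>2) * 1) has_derivative (\<lambda>v. ((2 * ?l x) *\<^sub>R x) \<bullet> v)) (at x)" for x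
    by (auto intro!: derivative_eq_intros has_derivative_conformal_factor)
  from infinity_harmonic_conformal_linear[of "\<lambda>x. 1 / (?l x)\<^sup>2" "\<lambda>_. 1", OF _ _ _ this]
  have "infinity_harmonic sphere_metric flat_metric ((*v) A)
      \<longleftrightarrow> A = 0 \<or> (\<forall>x. A *v ((2 * ?l x) *\<^sub>R x) = 0)"
    using riemannian_flat_metric riemannian_sphere_metric l
    by (simp add: flat_metric_def[abs_def] sphere_metric_def[abs_def])
  also have "\<dots> \<longleftrightarrow> A = 0"
    using l by (auto simp: matrix_vector_mult_scaleR matrix_eq)
  finally show ?thesis .
qed

text \<open>Every value is compared with the one at the origin, which is zero.\<close>

lemma matrix_vector_mult_constant_on_UNIV_iff:
  fixes A :: "real^'m^'n"
  shows "((*v) A) constant_on UNIV \<longleftrightarrow> A = 0"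
proof
  assume "((*v) A) constant_on UNIV"
  then have "A *v x = A *v 0" for x
    unfolding constant_on_def by (metis UNIV_I)
  then show "A = 0"
    by (simp add: matrix_eq)
qed (auto simp: constant_on_def)

theorem theorem3p3:
  fixes A :: "real^'m^'n" and \<phi> :: "real^'m \<Rightarrow> real^'n"
  assumes "\<And>X. \<phi> X = (\<chi> i. row i A \<bullet> X)"
  shows "(infinity_harmonic flat_metric sphere_metric \<phi> \<longleftrightarrow> A = 0)
       \<and> (infinity_harmonic sphere_metric flat_metric \<phi> \<longleftrightarrow> A = 0)
       \<and> (A = 0 \<longleftrightarrow> \<phi> constant_on UNIV)"
proof -
  have "\<phi> = (*v) A"
    by (simp add: fun_eq_iff assms vec_eq_iff matrix_vector_mul_component row_def vec_lambda_eta)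
  then show ?thesis
    by (simp add: infinity_harmonic_linear_into_sphere infinity_harmonic_linear_from_sphere
        matrix_vector_mult_constant_on_UNIV_iff)
qed

end
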